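(* Let $q=2^e$ with $e\ge 1$, and let $\alpha\in \mathbb{F}_{q^2}$ be an element satisfying $\alpha^q+\alpha=1$. Then the plane projective curve of degree $q/2$ with equation $$\sum_{i=0}^{e-1}(Y+\alpha^qX)^{2^i}Z^{q/2-2^i}=XZ^{q/2-1},$$ that is, $$(Y+\alpha^qX)^{q/2}+\cdots+(Y+\alpha^qX)^2Z^{q/2-2}+(Y+\alpha^qX)Z^{q/2-1}=XZ^{q/2-1},$$ is absolutely irreducible, and it intersects the Hermitian curve $\mathcal{H}_q$ given by $Y^qZ+YZ^q=X^{q+1}$ in $q(q+1)/2$ distinct $\mathbb{F}_{q^2}$-rational points.
   Context: A plane projective curve defined over $\mathbb{F}_{q^2}$ is given by a nonzero homogeneous polynomial in $X,Y,Z$ with coefficients in $\mathbb{F}_{q^2}$; it is absolutely irreducible if this polynomial is irreducible over an algebraic closure of $\mathbb{F}_{q^2}$. *)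

theory Defs
  imports "HOL-Algebra.Algebraic_Closure_Type" "HOL-Library.Cardinality"
begin

text \<open>
  The polynomial ring \<open>k[X,Y,Z]\<close> is represented as the iterated polynomial ring
  \<open>k[X][Y][Z]\<close>: \<open>X\<close> is the innermost and \<open>Z\<close> the outermost variable, so the coefficient of
  \<open>X^i Y^j Z^l\<close> in \<open>F\<close> is \<open>coeff (coeff (coeff F l) j) i\<close>.
\<close>

type_synonym 'k poly3 = "'k poly poly poly"

definition const3 :: "'k::field \<Rightarrow> 'k poly3" where
  "const3 c = [:[:[:c:]:]:]"

definition varX :: "'k::field poly3" where
  "varX = [:[:[:0, 1:]:]:]"

definition varY :: "'k::field poly3" where
  "varY = [:[:0, 1:]:]"

definition varZ :: "'k::field poly3" where
  "varZ = [:0, 1:]"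

fun eval3 :: "'k::field poly3 \<Rightarrow> 'k \<times> 'k \<times> 'k \<Rightarrow> 'k" where
  "eval3 F (x, y, z) = poly (poly (poly F [:[:z:]:]) [:y:]) x"

definition homogeneous3 :: "nat \<Rightarrow> 'k::field poly3 \<Rightarrow> bool" where
  "homogeneous3 d F \<longleftrightarrow>
     (\<forall>i j l. coeff (coeff (coeff F l) j) i \<noteq> 0 \<longrightarrow> i + j + l = d)"

definition plane_curve :: "nat \<Rightarrow> 'k::field poly3 \<Rightarrow> bool" where
  "plane_curve d F \<longleftrightarrow> F \<noteq> 0 \<and> homogeneous3 d F"

definition base_change3 :: "'k::field poly3 \<Rightarrow> 'k alg_closure poly3" where
  "base_change3 F = map_poly (map_poly (map_poly to_ac)) F"

definition absolutely_irreducible :: "'k::field poly3 \<Rightarrow> bool" where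
  "absolutely_irreducible F \<longleftrightarrow> irreducible (base_change3 F)"

definition proj_rel :: "(('k::field \<times> 'k \<times> 'k) \<times> ('k \<times> 'k \<times> 'k)) set" where
  "proj_rel = {((x, y, z), (x', y', z')).
     (x, y, z) \<noteq> (0, 0, 0) \<and> (\<exists>c. c \<noteq> 0 \<and> x' = c * x \<and> y' = c * y \<and> z' = c * z)}"

definition proj_plane :: "('k::field \<times> 'k \<times> 'k) set set" where
  "proj_plane = (UNIV - {(0, 0, 0)}) // proj_rel"

definition curve_points :: "'k::field poly3 \<Rightarrow> ('k \<times> 'k \<times> 'k) set set" where
  "curve_points F = {P \<in> proj_plane. \<forall>p\<in>P. eval3 F p = 0}"

text \<open>The points over the algebraic closure of a curve defined over \<open>k\<close>.\<close>

definition geometric_points ::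
    "'k::field poly3 \<Rightarrow> ('k alg_closure \<times> 'k alg_closure \<times> 'k alg_closure) set set" where
  "geometric_points F = curve_points (base_change3 F)"

text \<open>A point of the plane over the algebraic closure of \<open>k\<close> is \<open>k\<close>-rational if it has
  homogeneous coordinates in \<open>k\<close>.\<close>

definition rational_point ::
    "('k::field alg_closure \<times> 'k alg_closure \<times> 'k alg_closure) set \<Rightarrow> bool" where
  "rational_point P \<longleftrightarrow> (\<exists>a b c :: 'k. (to_ac a, to_ac b, to_ac c) \<in> P)"

definition hermitian_poly :: "nat \<Rightarrow> 'k::field poly3" where
  "hermitian_poly q = varY ^ q * varZ + varY * varZ ^ q - varX ^ (q + 1)"

text \<open>Used for \<open>q = 2 ^ e\<close> with \<open>e \<ge> 1\<close>, so that no subtraction in the exponents truncates.\<close>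

definition curve_poly :: "nat \<Rightarrow> nat \<Rightarrow> 'k::field \<Rightarrow> 'k poly3" where
  "curve_poly e q \<alpha> =
     (\<Sum>i<e. (varY + const3 (\<alpha> ^ q) * varX) ^ (2 ^ i) * varZ ^ (q div 2 - 2 ^ i))
     - varX * varZ ^ (q div 2 - 1)"

end

theory Submission
  imports Defs "HOL-Number_Theory.Residues"
begin

text \<open>
  Put \<open>u = Y + \<alpha>^q X\<close> and \<open>T(u) = u + u^2 + u^4 + \<dots> + u^(q/2)\<close>. The affine part of the curve
  is the graph \<open>X = T(u)\<close>, so in the variables \<open>X, u, Z\<close> the equation is linear in \<open>X\<close> with coprime
  coefficients, hence irreducible. No common point lies at infinity. Since
  \<open>T(u)^2 + T(u) = u^q + u\<close> in characteristic 2, substituting \<open>X = T(u)\<close> and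
  \<open>Y = u - \<alpha>^q T(u)\<close> in the Hermitian equation turns it into
  \<open>(T(u) + \<alpha>) (T(u)^q + T(u)) = 0\<close>, a separable equation of degree \<open>q(q+1)/2\<close>. Each of its
  roots satisfies \<open>u^(q^2) = u\<close>, so all intersection points are rational.
\<close>

section \<open>Ring homomorphisms and substitution in iterated polynomial rings\<close>

locale ring_map =
  fixes h :: "'a::comm_ring_1 \<Rightarrow> 'b::comm_ring_1"
  assumes map_one [simp]: "h 1 = 1"
    and map_add [simp]: "h (x + y) = h x + h y"
    and map_mult [simp]: "h (x * y) = h x * h y"
begin

lemma map_zero [simp]: "h 0 = 0"
  using map_add[of 0 0] by simp

lemma map_uminus [simp]: "h (- x) = - h x"
  using map_add[of x "- x"] by (simp add: eq_neg_iff_add_eq_0 add.commute)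

lemma map_diff [simp]: "h (x - y) = h x - h y"
  using map_add[of x "- y"] by simp

lemma map_power [simp]: "h (x ^ n) = h x ^ n"
  by (induction n) simp_all

lemma map_sum [simp]: "h (sum f A) = (\<Sum>x\<in>A. h (f x))"
  by (induction A rule: infinite_finite_induct) simp_all

lemma map_poly_add: "map_poly h (p + q) = map_poly h p + map_poly h q"
  by (rule poly_eqI) (simp add: coeff_map_poly)

lemma map_poly_mult: "map_poly h (p * q) = map_poly h p * map_poly h q"
  by (rule poly_eqI) (simp add: coeff_map_poly coeff_mult)

lemma ring_map_map_poly: "ring_map (map_poly h)"
  by unfold_locales (simp_all add: map_poly_add map_poly_mult)

lemma ring_map_poly: "ring_map (\<lambda>p. poly (map_poly h p) s)"
  by unfold_locales (simp_all add: map_poly_add map_poly_mult)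

end

lemma ring_map_comp: "ring_map g \<Longrightarrow> ring_map h \<Longrightarrow> ring_map (\<lambda>x. g (h x))"
  by (simp add: ring_map_def)

lemma ring_map_id: "ring_map (\<lambda>x. x)"
  by (simp add: ring_map_def)

lemma ring_map_const_poly: "ring_map (\<lambda>x. [:x:])"
  by unfold_locales (simp_all add: one_pCons)

lemma ring_map_const3: "ring_map const3"
  by unfold_locales (simp_all add: const3_def one_pCons)

lemma ring_map_to_ac: "ring_map to_ac"
  by unfold_locales simp_all

text \<open>Every polynomial arises from constants by repeated steps \<open>a + x * p\<close>, so
  constants and the indeterminate generate the ring.\<close>

lemma ring_map_poly_eqI:
  assumes g: "ring_map g" and h: "ring_map h"
    and const: "\<And>a. g [:a:] = h [:a:]" and var: "g [:0, 1:] = h [:0, 1:]"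
  shows "g p = h p"
proof (induction p)
  case (pCons a p)
  have "pCons a p = [:a:] + [:0, 1:] * p" by simp
  then show ?case
    using pCons const[of a] var by (metis ring_map.map_add[OF g] ring_map.map_add[OF h]
      ring_map.map_mult[OF g] ring_map.map_mult[OF h])
qed (simp add: ring_map.map_zero[OF g] ring_map.map_zero[OF h])

text \<open>The one-variable uniqueness is applied three times, from the innermost variable
  outwards, to the restrictions to the subrings of constants. This reduces checking that two
  coordinate changes are inverse to checking generators.\<close>

lemma ring_map_poly3_eqI:
  assumes g: "ring_map g" and h: "ring_map h"
    and "\<And>c. g (const3 c) = h (const3 c)"
    and "g varX = h varX" "g varY = h varY" "g varZ = h varZ"
  shows "g F = h F"
proof -
  have g2: "ring_map (\<lambda>p. g [:p:])" and h2: "ring_map (\<lambda>p. h [:p:])"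
    by (rule ring_map_comp[OF _ ring_map_const_poly]; fact)+
  have g1: "ring_map (\<lambda>p. g [:[:p:]:])" and h1: "ring_map (\<lambda>p. h [:[:p:]:])"
    by (rule ring_map_comp[OF _ ring_map_const_poly]; fact)+
  have "g [:[:p:]:] = h [:[:p:]:]" for p
    by (rule ring_map_poly_eqI[OF g1 h1]) (use assms in \<open>simp_all add: const3_def varX_def\<close>)
  then have "g [:p:] = h [:p:]" for p
    by (rule ring_map_poly_eqI[OF g2 h2]) (use assms in \<open>simp_all add: varY_def\<close>)
  then show ?thesis
    by (rule ring_map_poly_eqI[OF g h]) (use assms in \<open>simp_all add: varZ_def\<close>)
qed

text \<open>The algebra endomorphism sending X, Y, Z to \<open>x\<close>, \<open>y\<close>,
  \<open>z\<close>. The evaluations are nested because each variable lives in the coefficient ring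
  of the next one.\<close>

definition subst3 :: "'k::field poly3 \<Rightarrow> 'k poly3 \<Rightarrow> 'k poly3 \<Rightarrow> 'k poly3 \<Rightarrow> 'k poly3" where
  "subst3 x y z F =
     poly (map_poly (\<lambda>f. poly (map_poly (\<lambda>g. poly (map_poly const3 g) x) f) y) F) z"

lemma ring_map_subst3: "ring_map (subst3 x y z)"
  unfolding subst3_def[abs_def]
  by (intro ring_map.ring_map_poly ring_map_const3)

lemma subst3_const3 [simp]: "subst3 x y z (const3 c) = const3 c"
  and subst3_varX [simp]: "subst3 x y z varX = x"
  and subst3_varY [simp]: "subst3 x y z varY = y"
  and subst3_varZ [simp]: "subst3 x y z varZ = z"
proof -
  interpret ring_map const3 by (rule ring_map_const3)
  show "subst3 x y z (const3 c) = const3 c"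
    unfolding subst3_def const3_def[of c] by (simp add: map_poly_pCons const3_def)
  show "subst3 x y z varX = x" "subst3 x y z varY = y" "subst3 x y z varZ = z"
    unfolding subst3_def varX_def varY_def varZ_def by (simp_all add: map_poly_pCons)
qed

lemma ring_map_base_change3: "ring_map base_change3"
  unfolding base_change3_def[abs_def]
  by (intro ring_map.ring_map_map_poly ring_map_to_ac)

lemma base_change3_const3 [simp]: "base_change3 (const3 c) = const3 (to_ac c)"
  and base_change3_varX [simp]: "base_change3 varX = varX"
  and base_change3_varY [simp]: "base_change3 varY = varY"
  and base_change3_varZ [simp]: "base_change3 varZ = varZ"
  by (simp_all add: base_change3_def const3_def varX_def varY_def varZ_def map_poly_pCons)

lemma base_change3_curve_poly: "base_change3 (curve_poly e q \<alpha>) = curve_poly e q (to_ac \<alpha>)"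
proof -
  interpret ring_map base_change3 by (rule ring_map_base_change3)
  show ?thesis by (simp add: curve_poly_def)
qed

lemma base_change3_hermitian_poly: "base_change3 (hermitian_poly q) = hermitian_poly q"
proof -
  interpret ring_map base_change3 by (rule ring_map_base_change3)
  show ?thesis by (simp add: hermitian_poly_def)
qed

section \<open>Homogeneity of the curve equation\<close>

lemma homogeneous3_diff: "homogeneous3 d F \<Longrightarrow> homogeneous3 d G \<Longrightarrow> homogeneous3 d (F - G)"
  and homogeneous3_add: "homogeneous3 d F \<Longrightarrow> homogeneous3 d G \<Longrightarrow> homogeneous3 d (F + G)"
proof -
  assume F: "homogeneous3 d F" and G: "homogeneous3 d G"
  show "homogeneous3 d (F - G)"
    unfolding homogeneous3_def
  proof (intro allI impI)
    fix i j l assume "coeff (coeff (coeff (F - G) l) j) i \<noteq> 0"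
    then have "coeff (coeff (coeff F l) j) i \<noteq> 0 \<or> coeff (coeff (coeff G l) j) i \<noteq> 0" by auto
    then show "i + j + l = d" using F G by (auto simp: homogeneous3_def)
  qed
  show "homogeneous3 d (F + G)"
    unfolding homogeneous3_def
  proof (intro allI impI)
    fix i j l assume "coeff (coeff (coeff (F + G) l) j) i \<noteq> 0"
    then have "coeff (coeff (coeff F l) j) i \<noteq> 0 \<or> coeff (coeff (coeff G l) j) i \<noteq> 0" by auto
    then show "i + j + l = d" using F G by (auto simp: homogeneous3_def)
  qed
qed

lemma homogeneous3_sum: "(\<And>x. x \<in> A \<Longrightarrow> homogeneous3 d (f x)) \<Longrightarrow> homogeneous3 d (sum f A)"
proof (induction A rule: infinite_finite_induct)
  case (insert x A)
  then show ?case by (simp add: homogeneous3_add)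
qed (simp_all add: homogeneous3_def)

text \<open>A nonzero coefficient of the product forces a nonzero term in the threefold convolution,
  and the exponents of its two factors have sums \<open>m\<close> and \<open>n\<close>.\<close>

lemma homogeneous3_mult:
  assumes F: "homogeneous3 m F" and G: "homogeneous3 n G"
  shows "homogeneous3 (m + n) (F * G)"
  unfolding homogeneous3_def
proof (intro allI impI)
  fix i j l
  assume "coeff (coeff (coeff (F * G) l) j) i \<noteq> 0"
  then have "(\<Sum>a\<le>l. \<Sum>b\<le>j. \<Sum>c\<le>i. coeff (coeff (coeff F a) b) c *
      coeff (coeff (coeff G (l - a)) (j - b)) (i - c)) \<noteq> 0"
    by (simp add: coeff_mult coeff_sum)
  then obtain a b c where abc: "a \<le> l" "b \<le> j" "c \<le> i" and
    nz: "coeff (coeff (coeff F a) b) c * coeff (coeff (coeff G (l - a)) (j - b)) (i - c) \<noteq> 0"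
    by (metis (no_types, lifting) atMost_iff sum.neutral)
  have "c + b + a = m" "(i - c) + (j - b) + (l - a) = n"
    using nz F G unfolding homogeneous3_def by auto
  then show "i + j + l = m + n" using abc by simp
qed

lemma homogeneous3_const3: "homogeneous3 0 (const3 c)"
  and homogeneous3_varX: "homogeneous3 1 varX"
  and homogeneous3_varY: "homogeneous3 1 varY"
  and homogeneous3_varZ: "homogeneous3 1 varZ"
  by (auto simp: homogeneous3_def const3_def varX_def varY_def varZ_def coeff_pCons
      split: nat.splits)

lemma homogeneous3_power: "homogeneous3 m F \<Longrightarrow> homogeneous3 (n * m) (F ^ n)"
proof (induction n)
  case 0
  show ?case using homogeneous3_const3[of 1] by (simp add: ring_map.map_one[OF ring_map_const3])
next
  case (Suc n)
  then show ?case using homogeneous3_mult[of m F "n * m" "F ^ n"] by simp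
qed

lemma homogeneous3_curve_poly:
  assumes "e \<ge> 1"
  shows "homogeneous3 (2 ^ e div 2) (curve_poly e (2 ^ e) \<alpha>)"
  unfolding curve_poly_def
proof (intro homogeneous3_diff homogeneous3_sum)
  define d :: nat where "d = 2 ^ e div 2"
  \<comment> \<open>This form gives \<open>2 ^ i \<le> d\<close> for all \<open>i < e\<close>, so
    the subtractions in the exponents of Z are exact.\<close>
  have d: "d = 2 ^ (e - 1)" using assms by (cases e) (auto simp: d_def)
  show "homogeneous3 (2 ^ e div 2) (varX * varZ ^ (2 ^ e div 2 - 1) :: 'a poly3)"
    using homogeneous3_mult[OF homogeneous3_varX homogeneous3_power[OF homogeneous3_varZ], of "d - 1"] d
    by (simp add: d_def[symmetric])
  fix i assume "i \<in> {..<e}"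
  then have i: "(2::nat) ^ i \<le> d" by (auto simp: d)
  have "homogeneous3 1 (varY + const3 (\<alpha> ^ 2 ^ e) * varX)"
    using homogeneous3_mult[OF homogeneous3_const3 homogeneous3_varX]
    by (intro homogeneous3_add homogeneous3_varY) simp
  from homogeneous3_mult[OF homogeneous3_power[OF this] homogeneous3_power[OF homogeneous3_varZ],
      of "2 ^ i" "d - 2 ^ i"] i
  show "homogeneous3 (2 ^ e div 2)
    ((varY + const3 (\<alpha> ^ 2 ^ e) * varX) ^ 2 ^ i * varZ ^ (2 ^ e div 2 - 2 ^ i))"
    by (simp add: d_def[symmetric])
qed

section \<open>Irreducibility of the curve equation\<close>

text \<open>Degrees add up to 1, so one factor is a constant polynomial. It divides both
  coefficients, hence is a unit.\<close>

lemma irreducible_linear_poly: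
  fixes a b :: "'a::idom"
  assumes b: "b \<noteq> 0" and ab: "\<And>g. g dvd a \<Longrightarrow> g dvd b \<Longrightarrow> g dvd 1"
  shows "irreducible [:a, b:]"
proof (rule irreducibleI)
  show "[:a, b:] \<noteq> 0" using b by simp
  show "\<not> [:a, b:] dvd 1" using b by (auto simp: is_unit_poly_iff)
  fix G H assume eq: "[:a, b:] = G * H"
  have unit: "G' dvd 1" if eq': "[:a, b:] = G' * H'" and deg: "degree G' = 0" for G' H' :: "'a poly"
  proof -
    obtain g where g: "G' = [:g:]" using deg degree_eq_zeroE by blast
    have "[:g:] dvd [:a, b:]" unfolding eq' g by (rule dvd_triv_left)
    then have dvd: "g dvd coeff [:a, b:] n" for n by (simp only: const_poly_dvd_iff)
    have "g dvd a" "g dvd b" using dvd[of 0] dvd[of 1] by simp_all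
    then show ?thesis using ab g by (simp add: is_unit_const_poly_iff)
  qed
  have "G \<noteq> 0" "H \<noteq> 0" using eq b by auto
  then have "degree G + degree H = 1" using arg_cong[OF eq, of degree] b by (simp add: degree_mult_eq)
  then have "degree G = 0 \<or> degree H = 0" by linarith
  moreover have eq': "[:a, b:] = H * G" unfolding eq by (rule mult.commute)
  ultimately show "G dvd 1 \<or> H dvd 1" using unit[OF eq] unit[OF eq'] by blast
qed

text \<open>A factorization of \<open>x\<close> is carried by \<open>g\<close> to one of
  \<open>g x\<close>, and the left inverse \<open>h\<close> carries units back to units.\<close>

lemma irreducible_ring_map_imp:
  assumes g: "ring_map g" and h: "ring_map h"
    and hg: "\<And>x. h (g x) = x" and irr: "irreducible (g x)"
  shows "irreducible x"
proof -
  have unit: "y dvd 1" if "g y dvd 1" for y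
    using that by (metis dvd_def hg ring_map.map_mult[OF h] ring_map.map_one[OF h])
  show ?thesis
  proof (rule irreducibleI)
    show "x \<noteq> 0" using irr ring_map.map_zero[OF g] by auto
    show "\<not> x dvd 1" using irr
      by (metis dvd_def irreducible_not_unit ring_map.map_mult[OF g] ring_map.map_one[OF g])
    show "a dvd 1 \<or> b dvd 1" if "x = a * b" for a b
      using irreducibleD[OF irr, of "g a" "g b"] that unit ring_map.map_mult[OF g] by auto
  qed
qed

text \<open>Stated over any field so that it can be applied over the algebraic closure. A common
  divisor of \<open>A\<close> and \<open>B\<close> divides a polynomial free of U, so it is itself
  free of U, and then it divides the leading coefficient 1 of \<open>A\<close>.\<close>

lemma irreducible_curve_poly:
  fixes \<beta> :: "'k::field"
  assumes "e \<ge> 1"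
  shows "irreducible (curve_poly e (2 ^ e) \<beta>)"
proof -
  define d :: nat where "d = 2 ^ e div 2"
  have d: "d = 2 ^ (e - 1)" using assms by (cases e) (auto simp: d_def)
  define c where "c = \<beta> ^ 2 ^ e"
  \<comment> \<open>In \<open>A\<close> and \<open>B\<close> the outer variable
    \<open>[:0, 1:]\<close> stands for U and the inner one \<open>[:[:0, 1:]:]\<close> for
    Z.\<close>
  define A :: "'k poly poly" where
    "A = (\<Sum>i<e. [:0, 1:] ^ 2 ^ i * [:[:0, 1:]:] ^ (d - 2 ^ i))"
  define B :: "'k poly poly" where "B = - ([:[:0, 1:]:] ^ (d - 1))"
  \<comment> \<open>\<open>\<phi>\<close> expresses the curve in \<open>U = Y + c X\<close> and reorders the variables so that \<open>Z\<close> is innermost and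
    \<open>X\<close> outermost: the image is \<open>A + B X\<close> with \<open>A\<close> monic in \<open>U\<close> and \<open>B\<close> free of \<open>U\<close>.\<close>
  define \<phi> where "\<phi> = subst3 (varZ :: 'k poly3) (varY - const3 c * varZ) varX"
  define \<psi> where "\<psi> = subst3 (varZ :: 'k poly3) (varY + const3 c * varX) varX"
  interpret \<phi>: ring_map \<phi> unfolding \<phi>_def by (rule ring_map_subst3)
  interpret \<psi>: ring_map \<psi> unfolding \<psi>_def by (rule ring_map_subst3)
  have \<phi>_simps: "\<phi> (const3 a) = const3 a" "\<phi> varX = varZ" "\<phi> varY = varY - const3 c * varZ"
      "\<phi> varZ = varX" for a
    by (simp_all add: \<phi>_def)
  have \<psi>_simps: "\<psi> (const3 a) = const3 a" "\<psi> varX = varZ" "\<psi> varY = varY + const3 c * varX"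
      "\<psi> varZ = varX" for a
    by (simp_all add: \<psi>_def)
  have inv: "\<psi> (\<phi> F) = F" for F
    by (rule ring_map_poly3_eqI[OF ring_map_comp[OF \<psi>.ring_map_axioms \<phi>.ring_map_axioms] ring_map_id])
       (simp_all add: \<phi>_simps \<psi>_simps)
  interpret C: ring_map "\<lambda>x :: 'k poly poly. [:x:]" by (rule ring_map_const_poly)
  have "\<phi> (curve_poly e (2 ^ e) \<beta>) = (\<Sum>i<e. varY ^ 2 ^ i * varX ^ (d - 2 ^ i)) - varZ * varX ^ (d - 1)"
    unfolding curve_poly_def by (simp add: \<phi>_simps d_def c_def)
  also have "\<dots> = [:A:] + [:B:] * varZ"
    unfolding A_def B_def C.map_sum C.map_mult C.map_power C.map_uminus varX_def varY_def
    by simp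
  also have "\<dots> = [:A, B:]"
    by (simp add: varZ_def)
  finally have \<phi>F: "\<phi> (curve_poly e (2 ^ e) \<beta>) = [:A, B:]" .
  \<comment> \<open>\<open>2 ^ i = d\<close> only for \<open>i = e - 1\<close>, and there the
    exponent of Z is 0, so the coefficient of U^d is exactly 1.\<close>
  have "coeff A d = (\<Sum>i<e. if i = e - 1 then 1 else 0)"
    unfolding A_def coeff_sum
  proof (rule sum.cong[OF refl])
    fix i assume "i \<in> {..<e}"
    have "[:0, 1:] ^ 2 ^ i * [:[:0, 1:]:] ^ (d - 2 ^ i) = (monom ([:0, 1:] ^ (d - 2 ^ i)) (2 ^ i) :: 'k poly poly)"
      by (simp add: poly_const_pow monom_altdef)
    then show "coeff ([:0, 1:] ^ 2 ^ i * [:[:0, 1:]:] ^ (d - 2 ^ i)) d = (if i = e - 1 then 1 else (0 :: 'k poly))"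
      by (auto simp: d)
  qed
  then have lead: "coeff A d = 1" using assms by simp
  have B0: "B = [:- ([:0, 1:] ^ (d - 1)):]"
    by (simp add: B_def poly_const_pow)
  have "irreducible [:A, B:]"
  proof (rule irreducible_linear_poly)
    show "B \<noteq> 0" by (simp add: B_def)
    fix g assume g: "g dvd A" "g dvd B"
    have "degree g \<le> degree B" using g(2) by (intro dvd_imp_degree_le) (simp_all add: B_def)
    then have "degree g = 0" by (simp add: B0)
    then obtain h where h: "g = [:h:]" using degree_eq_zeroE by blast
    then have "h dvd coeff A d" using g(1) by (simp add: const_poly_dvd_iff)
    then show "g dvd 1" using lead h by (simp add: is_unit_const_poly_iff)
  qed
  then show ?thesis
    using irreducible_ring_map_imp[OF \<phi>.ring_map_axioms \<psi>.ring_map_axioms inv] \<phi>F by metis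
qed

section \<open>Separable polynomials over an algebraically closed field\<close>

text \<open>The polynomial splits into linear factors, and a repeated factor would give a common
  root with the derivative. So the multiset of roots has no multiplicities and its size is the
  degree.\<close>

lemma card_roots_separable:
  fixes p :: "'a::alg_closed_field poly"
  assumes sep: "\<And>x. poly p x = 0 \<Longrightarrow> poly (pderiv p) x \<noteq> 0"
  shows "card {x. poly p x = 0} = degree p"
proof -
  \<comment> \<open>The zero polynomial has 0 as a root where its derivative vanishes too, which
    \<open>sep\<close> excludes.\<close>
  have p: "p \<noteq> 0" using sep[of 0] by auto
  then obtain A where A: "size A = degree p" "p = smult (lead_coeff p) (\<Prod>x\<in>#A. [:-x, 1:])"
    using alg_closed_imp_factorization by blast
  have count: "count A x \<le> 1" for x
  proof (rule ccontr)
    assume "\<not> count A x \<le> 1"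
    then have "{#x, x#} \<subseteq># A" by (auto simp: subseteq_mset_def)
    then obtain B where "A = {#x, x#} + B" by (metis subset_mset.add_diff_inverse)
    then have "p = [:-x, 1:] * ([:-x, 1:] * smult (lead_coeff p) (\<Prod>x\<in>#B. [:-x, 1:]))"
      using A(2) by (simp add: mult_smult_right)
    then obtain r where r: "p = [:-x, 1:] * ([:-x, 1:] * r)" by blast
    have "poly p x = 0" "poly (pderiv p) x = 0"
      unfolding r pderiv_mult poly_mult poly_add by simp_all
    then show False using sep by blast
  qed
  have "count A x = 1" if "x \<in># A" for x
    using that count[of x] by (simp add: le_antisym Suc_leI)
  then have "card (set_mset A) = size A"
    by (simp add: size_multiset_overloaded_eq)
  moreover have "set_mset A = {x. poly p x = 0}"
    by (subst A(2)) (use p in \<open>auto simp: poly_prod_mset prod_mset_zero_iff\<close>)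
  ultimately show ?thesis using A(1) by simp
qed


section \<open>Characteristic 2 and the trace polynomial T\<close>

lemma CHAR_2_add_self: "CHAR('a::comm_ring_1) = 2 \<Longrightarrow> x + x = (0::'a)"
  by (metis mult_2 mult_zero_left of_nat_CHAR of_nat_numeral)

lemma CHAR_2_diff: "CHAR('a::comm_ring_1) = 2 \<Longrightarrow> x - y = x + (y::'a)"
  using CHAR_2_add_self[of y] by (simp add: diff_eq_eq add.assoc)

lemma CHAR_2_power_add:
  "CHAR('a::comm_ring_1) = 2 \<Longrightarrow> (x + y) ^ 2 ^ n = x ^ 2 ^ n + (y::'a) ^ 2 ^ n"
  by (rule freshmans_dream') simp_all

text \<open>The polynomial T(u), whose formula is that of the absolute trace on the field with
  \<open>2 ^ e\<close> elements. The general type allows its use both on field elements and on the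
  indeterminate \<open>[:0, 1:]\<close>.\<close>

definition trace_sum :: "nat \<Rightarrow> 'a::comm_semiring_1 \<Rightarrow> 'a" where
  "trace_sum e u = (\<Sum>i<e. u ^ 2 ^ i)"

lemma trace_sum_0 [simp]: "trace_sum 0 u = 0"
  and trace_sum_Suc [simp]: "trace_sum (Suc e) u = trace_sum e u + u ^ 2 ^ e"
  by (simp_all add: trace_sum_def)

text \<open>Squaring is additive and shifts the summands of T by one place, so T^2 + T telescopes to
  its two end terms.\<close>

lemma trace_sum_square:
  fixes u :: "'a::comm_ring_1"
  assumes char: "CHAR('a) = 2"
  shows "u ^ 2 ^ e = trace_sum e u ^ 2 + trace_sum e u + u"
proof (induction e)
  case (Suc e)
  define t w where "t = trace_sum e u" and "w = u ^ 2 ^ e"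
  have "(t + w) ^ 2 = t ^ 2 + w ^ 2" using CHAR_2_power_add[OF char, of t w 1] by simp
  moreover have "w = t ^ 2 + t + u" using Suc by (simp add: t_def w_def)
  moreover have "t\<^sup>2 + w + (t + u) = w + w" using calculation(2) by (simp add: algebra_simps)
  moreover have "u ^ 2 ^ Suc e = w ^ 2" by (simp add: w_def power_mult mult.commute[of 2])
  ultimately have "trace_sum (Suc e) u ^ 2 + trace_sum (Suc e) u + u = u ^ 2 ^ Suc e + (w + w)"
    by (simp add: t_def[symmetric] w_def[symmetric] add_ac)
  then show ?case by (simp add: CHAR_2_add_self[OF char])
qed simp

text \<open>The strict bound lets the next summand u^(2^e) dominate, which then yields the exact
  degree.\<close>

lemma degree_trace_sum_less: "degree (trace_sum e [:0, 1 :: 'a::field:]) < 2 ^ e"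
proof (induction e)
  case (Suc e)
  have "degree (trace_sum e [:0, 1 :: 'a:] + [:0, 1:] ^ 2 ^ e) \<le> 2 ^ e"
    using Suc by (intro degree_add_le) (simp_all add: degree_power_eq)
  also have "\<dots> < 2 ^ Suc e" by simp
  finally show ?case by simp
qed simp

lemma degree_trace_sum: "degree (trace_sum (Suc e) [:0, 1 :: 'a::field:]) = 2 ^ e"
  using degree_trace_sum_less[of e, where 'a = 'a]
  by (simp add: degree_add_eq_right degree_power_eq)

text \<open>All summands after the first have even exponents, so only u contributes to the
  derivative.\<close>

lemma pderiv_trace_sum:
  assumes char: "CHAR('a::field) = 2"
  shows "pderiv (trace_sum (Suc e) [:0, 1 :: 'a:]) = 1"
proof (induction e)
  case (Suc e)
  have "of_nat (2 ^ Suc e) = (0 :: 'a)" unfolding of_nat_eq_0_iff_char_dvd char by simp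
  then have "pderiv ([:0, 1 :: 'a:] ^ 2 ^ Suc e) = 0" by (simp only: pderiv_power) simp
  then show ?case using Suc by (simp only: trace_sum_Suc[of "Suc e"] pderiv_add) simp
qed (simp add: pderiv_pCons one_pCons)

lemma poly_trace_sum: "poly (trace_sum e p) x = trace_sum e (poly p x)"
  by (simp add: trace_sum_def poly_sum)

text \<open>Both factors of \<open>p\<close> have derivative 1, since T' = 1 and \<open>q\<close>
  vanishes in the field, so \<open>p'\<close> is their sum. A common root of \<open>p\<close> and
  \<open>p'\<close> kills both factors and gives T = \<open>\<beta>\<close> and T^q = T,
  contradicting \<open>\<beta> ^ q = \<beta> + 1\<close>. The degree is q/2 + q * (q/2).\<close>

lemma card_parameters:
  fixes \<beta> :: "'k::alg_closed_field"
  assumes e: "e \<ge> 1" and q: "q = 2 ^ e" and char: "CHAR('k) = 2" and \<beta>: "\<beta> ^ q = \<beta> + 1"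
  shows "card {u. (trace_sum e u + \<beta>) * (trace_sum e u ^ q + trace_sum e u) = 0} = q * (q + 1) div 2"
proof -
  define T where "T = trace_sum e [:0, 1 :: 'k:]"
  define p where "p = (T + [:\<beta>:]) * (T ^ q + T)"
  obtain n where n: "e = Suc n" using e by (cases e) auto
  define d :: nat where "d = 2 ^ n"
  have qd: "q = 2 * d" and d: "d > 0" by (simp_all add: q n d_def)
  have degT: "degree T = d" unfolding T_def n d_def by (rule degree_trace_sum)
  have pderT: "pderiv T = 1" unfolding T_def n by (rule pderiv_trace_sum[OF char])
  have T0: "T \<noteq> 0" using degT d by auto
  have q0: "of_nat q = (0 :: 'k)" unfolding of_nat_eq_0_iff_char_dvd char qd by simp
  have poly_T: "poly T x = trace_sum e x" for x by (simp add: T_def poly_trace_sum)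
  have deg1: "degree (T + [:\<beta>:]) = d" using degT d by (simp add: degree_add_eq_left)
  have degTq: "degree (T ^ q) = q * d" using T0 degT by (simp add: degree_power_eq)
  have "d < q * d" using d by (simp add: qd)
  then have deg2: "degree (T ^ q + T) = q * d" using degT degTq by (simp add: degree_add_eq_left)
  have "T + [:\<beta>:] \<noteq> 0" "T ^ q + T \<noteq> 0" using deg1 deg2 d by (auto simp: qd)
  then have degp: "degree p = d + q * d" using deg1 deg2 by (simp add: p_def degree_mult_eq)
  have pd: "pderiv p = (T ^ q + T) + (T + [:\<beta>:])"
    unfolding p_def by (simp add: pderiv_mult pderiv_add pderiv_power q0 pderT pderiv_pCons)
  have "poly (pderiv p) x \<noteq> 0" if "poly p x = 0" for x
  proof
    assume "poly (pderiv p) x = 0"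
    then have "poly (T ^ q + T) x + poly (T + [:\<beta>:]) x = 0"
      unfolding pd by (simp only: poly_add)
    moreover have "poly (T ^ q + T) x = 0 \<or> poly (T + [:\<beta>:]) x = 0"
      using that by (auto simp: p_def)
    ultimately have "poly (T + [:\<beta>:]) x = 0" "poly (T ^ q + T) x = 0"
      by (metis add_0 add.right_neutral)+
    then have "poly T x = \<beta>" "poly T x ^ q + poly T x = 0"
      using CHAR_2_diff[OF char, of "poly T x" \<beta>] by auto
    then have "(1 :: 'k) = 0" using \<beta> CHAR_2_add_self[OF char, of \<beta>] by (simp add: add_ac)
    then show False by simp
  qed
  then have "card {x. poly p x = 0} = d + q * d"
    using card_roots_separable degp by metis
  moreover have "poly p x = (trace_sum e x + \<beta>) * (trace_sum e x ^ q + trace_sum e x)" for x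
    by (simp add: p_def poly_T)
  moreover have "d + q * d = q * (q + 1) div 2" by (simp add: qd algebra_simps)
  ultimately show ?thesis by simp
qed

section \<open>Projective points and the affine chart Z = 1\<close>

lemma eval3_curve_poly: "eval3 (curve_poly e q \<beta>) (x, y, z) =
    (\<Sum>i<e. (y + \<beta> ^ q * x) ^ 2 ^ i * z ^ (q div 2 - 2 ^ i)) - x * z ^ (q div 2 - 1)"
  by (simp add: curve_poly_def poly_sum const3_def varX_def varY_def varZ_def mult.commute)

lemma eval3_hermitian_poly: "eval3 (hermitian_poly q) (x, y, z) = y ^ q * z + y * z ^ q - x ^ (q + 1)"
  by (simp add: hermitian_poly_def varX_def varY_def varZ_def)

lemma eval3_curve_poly_scale:
  assumes "e \<ge> 1"
  shows "eval3 (curve_poly e (2 ^ e) \<beta>) (c * x, c * y, c * z) =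
    c ^ (2 ^ e div 2) * eval3 (curve_poly e (2 ^ e) \<beta>) (x, y, z)"
proof -
  define d :: nat where "d = 2 ^ e div 2"
  have d: "d = 2 ^ (e - 1)" using assms by (cases e) (auto simp: d_def)
  have scale: "(c * y + \<beta> ^ 2 ^ e * (c * x)) ^ 2 ^ i * (c * z) ^ (d - 2 ^ i) =
      c ^ d * ((y + \<beta> ^ 2 ^ e * x) ^ 2 ^ i * z ^ (d - 2 ^ i))" if "i < e" for i
  proof -
    have "2 ^ i \<le> d" using that by (auto simp: d)
    then have "c ^ d = c ^ 2 ^ i * c ^ (d - 2 ^ i)" by (simp flip: power_add)
    moreover have "c * y + \<beta> ^ 2 ^ e * (c * x) = c * (y + \<beta> ^ 2 ^ e * x)" by (simp add: algebra_simps)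
    ultimately show ?thesis by (simp add: power_mult_distrib mult_ac)
  qed
  have sum: "(\<Sum>i<e. (c * y + \<beta> ^ 2 ^ e * (c * x)) ^ 2 ^ i * (c * z) ^ (d - 2 ^ i)) =
      c ^ d * (\<Sum>i<e. (y + \<beta> ^ 2 ^ e * x) ^ 2 ^ i * z ^ (d - 2 ^ i))"
    unfolding sum_distrib_left by (rule sum.cong[OF refl], rule scale, simp)
  have "d = Suc (d - 1)" by (simp add: d)
  then have "c ^ d = c * c ^ (d - 1)" by (metis power_Suc)
  then have monomial: "c * x * (c * z) ^ (d - 1) = c ^ d * (x * z ^ (d - 1))"
    by (simp add: power_mult_distrib mult_ac)
  show ?thesis
    unfolding eval3_curve_poly d_def[symmetric] right_diff_distrib sum monomial ..
qed

lemma eval3_hermitian_poly_scale: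
  "eval3 (hermitian_poly q) (c * x, c * y, c * z) = c ^ (q + 1) * eval3 (hermitian_poly q) (x, y, z)"
  unfolding eval3_hermitian_poly by (simp add: algebra_simps power_mult_distrib)

lemma proj_rel_class:
  "(x, y, z) \<noteq> (0, 0, 0) \<Longrightarrow> proj_rel `` {(x, y, z)} = {(c * x, c * y, c * z) | c. c \<noteq> 0}"
  by (auto simp: proj_rel_def)

lemma proj_rel_class_affine:
  fixes x y z :: "'k::field"
  assumes "z \<noteq> 0"
  shows "proj_rel `` {(x, y, z)} = proj_rel `` {(x / z, y / z, 1)}"
proof -
  have "{(c * x, c * y, c * z) | c. c \<noteq> 0} = {(c * (x / z), c * (y / z), c * 1) | c. c \<noteq> 0}"
    (is "?A = ?B")
  proof (intro equalityI subsetI)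
    fix v assume "v \<in> ?A"
    then obtain c where "c \<noteq> 0" "v = (c * x, c * y, c * z)" by blast
    then show "v \<in> ?B" using assms by (auto intro!: exI[of _ "c * z"])
  next
    fix v assume "v \<in> ?B"
    then obtain c where "c \<noteq> 0" "v = (c * (x / z), c * (y / z), c)" by auto
    then show "v \<in> ?A" using assms by (auto intro!: exI[of _ "c / z"])
  qed
  then show ?thesis using assms by (simp add: proj_rel_class)
qed

text \<open>Membership in \<open>curve_points\<close> demands vanishing at all representatives; the
  scaling law reduces this to a single one.\<close>

lemma proj_class_affine_in_curve_points:
  assumes "\<And>c x y z. eval3 F (c * x, c * y, c * z) = c ^ d * eval3 F (x, y, z)"
    and "eval3 F (x, y, 1) = 0"
  shows "proj_rel `` {(x, y, 1)} \<in> curve_points F"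
  unfolding curve_points_def
proof (intro CollectI conjI ballI)
  show "proj_rel `` {(x, y, 1)} \<in> proj_plane"
    unfolding proj_plane_def by (rule quotientI) simp
  fix p assume "p \<in> proj_rel `` {(x, y, 1)}"
  then obtain c where "p = (c * x, c * y, c * 1)" by (auto simp: proj_rel_class)
  then show "eval3 F p = 0" using assms(1)[of c x y 1] assms(2) by (simp del: eval3.simps)
qed

section \<open>Parametrization of the intersection by u\<close>

text \<open>The solution of u = Y + \<open>\<beta>\<close>^q X and X = T(u) with Z = 1 and q =
  2^e.\<close>

definition affine_point :: "nat \<Rightarrow> 'k::field \<Rightarrow> 'k \<Rightarrow> ('k \<times> 'k \<times> 'k) set" where
  "affine_point e \<beta> u = proj_rel `` {(trace_sum e u, u - \<beta> ^ 2 ^ e * trace_sum e u, 1)}"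

text \<open>A class has at most one representative with last coordinate 1, and its first two
  coordinates determine u.\<close>

lemma inj_affine_point: "inj (affine_point e \<beta>)"
proof (rule injI)
  fix u v assume "affine_point e \<beta> u = affine_point e \<beta> v"
  moreover have "(trace_sum e u, u - \<beta> ^ 2 ^ e * trace_sum e u, 1) \<in> affine_point e \<beta> u"
    by (auto simp: affine_point_def proj_rel_class intro!: exI[of _ 1])
  ultimately show "u = v" by (auto simp: affine_point_def proj_rel_class)
qed

text \<open>With t = T(u), the ordinate is u + (\<open>\<beta>\<close> + 1) t and its q-th power is
  (t^2 + t + u) + \<open>\<beta>\<close> t^q. In the Hermitian equation u and one copy of t cancel
  in pairs, and the remaining terms factor.\<close>

lemma affine_point_on_hermitian:
  fixes \<beta> :: "'k::field"
  assumes char: "CHAR('k) = 2" and \<beta>: "\<beta> ^ 2 ^ e = \<beta> + 1"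
  shows "eval3 (hermitian_poly (2 ^ e)) (trace_sum e u, u - \<beta> ^ 2 ^ e * trace_sum e u, 1) =
    (trace_sum e u + \<beta>) * (trace_sum e u ^ 2 ^ e + trace_sum e u)"
proof -
  define t where "t = trace_sum e u"
  note diff = CHAR_2_diff[OF char] and two = CHAR_2_add_self[OF char]
  have \<beta>': "(\<beta> + 1) ^ 2 ^ e = \<beta>"
    using CHAR_2_power_add[OF char, of \<beta> 1 e] two[of 1] by (simp add: \<beta> add.assoc)
  have "(u + (\<beta> + 1) * t) ^ 2 ^ e = (t ^ 2 + t + u) + \<beta> * t ^ 2 ^ e"
    unfolding CHAR_2_power_add[OF char, of u] power_mult_distrib \<beta>' t_def
    using trace_sum_square[OF char, of u e] by simp
  then have "eval3 (hermitian_poly (2 ^ e)) (t, u - \<beta> ^ 2 ^ e * t, 1) =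
      (t ^ 2 + t + u) + \<beta> * t ^ 2 ^ e + (u + (\<beta> + 1) * t) + t * t ^ 2 ^ e"
    unfolding eval3_hermitian_poly by (simp add: \<beta> diff)
  also have "\<dots> = (t + \<beta>) * (t ^ 2 ^ e + t) + (u + u) + (t + t)"
    by (simp add: algebra_simps power2_eq_square)
  finally show ?thesis by (simp add: two t_def)
qed

lemma curve_points_inter_hermitian:
  fixes \<beta> :: "'k::field"
  assumes e: "e \<ge> 1" and q: "q = 2 ^ e" and char: "CHAR('k) = 2" and \<beta>: "\<beta> ^ q = \<beta> + 1"
  shows "curve_points (curve_poly e q \<beta>) \<inter> curve_points (hermitian_poly q) =
    affine_point e \<beta> ` {u. (trace_sum e u + \<beta>) * (trace_sum e u ^ q + trace_sum e u) = 0}"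
    (is "?L = affine_point e \<beta> ` ?S")
proof (intro equalityI subsetI)
  have affine: "eval3 (curve_poly e q \<beta>) (x, y, 1) = trace_sum e (y + \<beta> ^ q * x) - x" for x y
    by (simp add: eval3_curve_poly trace_sum_def del: eval3.simps)
  {
    fix P assume P: "P \<in> ?L"
    then obtain x y z where xyz: "(x, y, z) \<noteq> (0, 0, 0)" "P = proj_rel `` {(x, y, z)}"
      unfolding curve_points_def proj_plane_def by (auto elim!: quotientE)
    have "(x, y, z) \<in> P" using xyz by (auto simp: proj_rel_class intro!: exI[of _ 1])
    with P have zero: "eval3 (curve_poly e q \<beta>) (x, y, z) = 0" "eval3 (hermitian_poly q) (x, y, z) = 0"
      unfolding curve_points_def by blast+
    have "z \<noteq> 0"
    proof
      \<comment> \<open>At infinity the Hermitian equation leaves x^(q+1) = 0. Then x = 0 also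
        removes the term X Z^(q/2-1), whose Z-exponent is 0 when q = 2.\<close>
      assume z: "z = 0"
      then have x: "x = 0" using zero(2) q by (simp add: eval3_hermitian_poly zero_power del: eval3.simps)
      \<comment> \<open>Only \<open>i = e - 1\<close> has Z-exponent 0, where
        \<open>0 ^ 0 = 1\<close>; so the curve equation becomes y^(q/2) = 0.\<close>
      have "(\<Sum>i<e. y ^ 2 ^ i * 0 ^ (q div 2 - 2 ^ i)) = (\<Sum>i<e. if i = e - 1 then y ^ (q div 2) else 0)"
      proof (rule sum.cong[OF refl])
        fix i assume "i \<in> {..<e}"
        moreover have "q div 2 = 2 ^ (e - 1)" using e by (cases e) (auto simp: q)
        ultimately show "y ^ 2 ^ i * 0 ^ (q div 2 - 2 ^ i) = (if i = e - 1 then y ^ (q div 2) else 0)"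
          by (auto simp: power_0_left)
      qed
      also have "\<dots> = y ^ (q div 2)" using e by simp
      finally have "y = 0" using zero(1) x z by (simp add: eval3_curve_poly del: eval3.simps)
      then show False using x z xyz by simp
    qed
    define x' y' where "x' = x / z" and "y' = y / z"
    have P': "P = proj_rel `` {(x', y', 1)}"
      unfolding x'_def y'_def xyz(2) using \<open>z \<noteq> 0\<close> by (rule proj_rel_class_affine)
    then have "(x', y', 1) \<in> P" by (auto simp: proj_rel_class intro!: exI[of _ 1])
    with P have zero': "eval3 (curve_poly e q \<beta>) (x', y', 1) = 0" "eval3 (hermitian_poly q) (x', y', 1) = 0"
      unfolding curve_points_def by blast+
    define u where "u = y' + \<beta> ^ q * x'"
    have x': "x' = trace_sum e u" using zero'(1) by (simp add: affine u_def del: eval3.simps)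
    have y': "y' = u - \<beta> ^ q * trace_sum e u"
      unfolding x'[symmetric] by (simp add: u_def)
    have "u \<in> ?S"
      using zero'(2) affine_point_on_hermitian[OF char, of \<beta> e u] \<beta> unfolding x' y' q
      by (simp del: eval3.simps)
    moreover have "P = affine_point e \<beta> u" unfolding affine_point_def P' x' y' q ..
    ultimately show "P \<in> affine_point e \<beta> ` ?S" by blast
  next
    fix P assume "P \<in> affine_point e \<beta> ` ?S"
    then obtain u where u: "u \<in> ?S" "P = affine_point e \<beta> u" by blast
    have "eval3 (curve_poly e q \<beta>) (trace_sum e u, u - \<beta> ^ 2 ^ e * trace_sum e u, 1) = 0"
      unfolding q[symmetric] affine by simp
    moreover have "eval3 (hermitian_poly q) (trace_sum e u, u - \<beta> ^ 2 ^ e * trace_sum e u, 1) = 0"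
      using u(1) affine_point_on_hermitian[OF char, of \<beta> e u] \<beta> by (simp add: q del: eval3.simps)
    ultimately show "P \<in> ?L"
      unfolding u(2) affine_point_def q
      using eval3_curve_poly_scale[OF e, of \<beta>] eval3_hermitian_poly_scale[of "2 ^ e" , where 'a = 'k]
      by (intro IntI proj_class_affine_in_curve_points)
  }
qed

section \<open>Rationality of the intersection points\<close>

text \<open>Either t = \<open>\<beta>\<close> or t^q = t, so t^q is t + 1 or t. The expression t^2 +
  t is the same for both, hence is fixed by the q-th power map. Since u^q = u + (t^2 + t), applying
  that map twice adds t^2 + t twice, which is 0.\<close>

lemma parameter_power_square:
  fixes \<beta> :: "'k::field"
  assumes q: "q = 2 ^ e" and char: "CHAR('k) = 2" and \<beta>: "\<beta> ^ q = \<beta> + 1"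
    and u: "(trace_sum e u + \<beta>) * (trace_sum e u ^ q + trace_sum e u) = 0"
  shows "u ^ q ^ 2 = u"
proof -
  define t where "t = trace_sum e u"
  note two = CHAR_2_add_self[OF char] and add_power = CHAR_2_power_add[OF char, of _ _ e, folded q]
  have uq: "u ^ q = t ^ 2 + t + u" unfolding q t_def by (rule trace_sum_square[OF char])
  have eq_iff: "x + y = 0 \<longleftrightarrow> x = y" for x y :: 'k
    by (metis CHAR_2_diff[OF char] right_minus_eq)
  have "t = \<beta> \<or> t ^ q = t" using u by (simp add: eq_iff flip: t_def)
  then have "t ^ q = t \<or> t ^ q = t + 1" using \<beta> by auto
  then have "(t ^ q) ^ 2 + t ^ q = t ^ 2 + t"
  proof
    assume "t ^ q = t + 1"
    then have "(t ^ q) ^ 2 + t ^ q = t ^ 2 + t + ((t + t) + (1 + 1))"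
      by (simp add: power2_eq_square algebra_simps)
    then show ?thesis by (simp only: two) simp
  qed simp
  moreover have "(t ^ 2) ^ q = (t ^ q) ^ 2" by (simp add: mult.commute flip: power_mult)
  ultimately have "(u ^ q) ^ q = (t ^ 2 + t) + ((t ^ 2 + t) + u)"
    unfolding uq by (simp add: add_power uq)
  also have "\<dots> = u" by (simp only: two flip: add.assoc) simp
  finally show ?thesis by (simp add: power2_eq_square power_mult)
qed

text \<open>The library proves this only for the class \<open>finite_field\<close>, which the sort
  \<open>{field, finite}\<close> does not entail.\<close>

lemma power_CARD_eq_self: "x ^ CARD('a) = (x :: 'a::{field,finite})"
proof (cases "x = 0")
  case False
  have "(\<Prod>y\<in>UNIV-{0}. x * y) = (\<Prod>y\<in>UNIV-{0}. y)"
    by (rule prod.reindex_bij_witness[of _ "\<lambda>y. y / x" "\<lambda>y. x * y"]) (use False in auto)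
  then have "x ^ (CARD('a) - 1) = 1" by (simp add: prod.distrib card_Diff_singleton)
  then show ?thesis using power_minus_mult[of "CARD('a)" x] by simp
qed (simp add: zero_power)

text \<open>The polynomial x^N - x with N = \<open>CARD('a)\<close> has at most N roots, and the N
  elements of the base field already are roots.\<close>

lemma range_to_ac_finite:
  fixes u :: "'a::{field,finite} alg_closure"
  assumes u: "u ^ CARD('a) = u"
  shows "u \<in> range to_ac"
proof -
  define p :: "'a alg_closure poly" where "p = monom 1 CARD('a) - monom 1 1"
  have "card {0, 1 :: 'a} \<le> CARD('a)" by (rule card_mono) auto
  \<comment> \<open>This keeps the two monomials of \<open>p\<close> from cancelling.\<close>
  then have gt: "CARD('a) > 1" by simp
  have "coeff p CARD('a) = 1" using gt by (simp add: p_def)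
  then have p0: "p \<noteq> 0" by auto
  have deg: "degree p \<le> CARD('a)"
    unfolding p_def using gt by (intro degree_diff_le) (auto simp: degree_monom_eq)
  have "range to_ac \<subseteq> {x. poly p x = 0}"
    by (auto simp: p_def poly_monom power_CARD_eq_self simp flip: to_ac_power)
  moreover have "card (range (to_ac :: 'a \<Rightarrow> _)) = CARD('a)" by (simp add: card_image inj_to_ac)
  ultimately have "range to_ac = {x. poly p x = 0}"
    using card_poly_roots_bound[OF p0] deg by (intro card_seteq poly_roots_finite p0) auto
  moreover have "poly p u = 0" using u by (simp add: p_def poly_monom)
  ultimately show ?thesis by blast
qed

theorem corollary2p4:
  fixes e q :: nat and \<alpha> :: "'a::{field,finite}"
  assumes "e \<ge> 1" and "q = 2 ^ e"
    and "CARD('a) = q ^ 2"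
    and "\<alpha> ^ q + \<alpha> = 1"
  shows "plane_curve (q div 2) (curve_poly e q \<alpha>)
    \<and> absolutely_irreducible (curve_poly e q \<alpha>)
    \<and> card (geometric_points (curve_poly e q \<alpha>) \<inter>
            geometric_points (hermitian_poly q :: 'a poly3)) = q * (q + 1) div 2
    \<and> (\<forall>P \<in> geometric_points (curve_poly e q \<alpha>) \<inter>
             geometric_points (hermitian_poly q :: 'a poly3). rational_point P)"
proof -
  define \<beta> where "\<beta> = to_ac \<alpha>"
  have prime: "prime CHAR('a)"
    by (intro prime_CHAR_semidom finite_imp_CHAR_pos) simp
  \<comment> \<open>The characteristic is a prime dividing the field size q^2, a power of 2.\<close>
  have "CHAR('a) dvd 2 ^ (e * 2)"
    using CHAR_dvd_CARD[where 'a = 'a] assms by (simp add: power_mult)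
  then have char: "CHAR('a) = 2"
    using prime prime_dvd_power primes_dvd_imp_eq two_is_prime_nat by blast
  then have char': "CHAR('a alg_closure) = 2" by simp
  have "\<alpha> ^ q = \<alpha> + 1"
    using assms(4) by (metis CHAR_2_diff[OF char] add.commute add_diff_cancel_right')
  then have \<beta>: "\<beta> ^ q = \<beta> + 1" by (simp add: \<beta>_def flip: to_ac_power)
  have irr: "absolutely_irreducible (curve_poly e q \<alpha>)"
    unfolding absolutely_irreducible_def base_change3_curve_poly assms(2)
    by (rule irreducible_curve_poly[OF assms(1)])
  then have "curve_poly e q \<alpha> \<noteq> 0"
    by (auto simp: absolutely_irreducible_def base_change3_def)
  then have plane: "plane_curve (q div 2) (curve_poly e q \<alpha>)"
    using homogeneous3_curve_poly[OF assms(1)] by (simp add: plane_curve_def assms(2))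
  define S where "S = {u. (trace_sum e u + \<beta>) * (trace_sum e u ^ q + trace_sum e u) = 0}"
  have points: "geometric_points (curve_poly e q \<alpha>) \<inter> geometric_points (hermitian_poly q :: 'a poly3) =
      affine_point e \<beta> ` S"
    unfolding geometric_points_def base_change3_curve_poly base_change3_hermitian_poly S_def
    using curve_points_inter_hermitian[OF assms(1,2) char' \<beta>] by (simp only: \<beta>_def)
  have "card S = q * (q + 1) div 2"
    unfolding S_def by (rule card_parameters[OF assms(1,2) char' \<beta>])
  then have "card (affine_point e \<beta> ` S) = q * (q + 1) div 2"
    using card_image[OF inj_on_subset[OF inj_affine_point]] by (metis subset_UNIV)
  moreover have "rational_point P" if P: "P \<in> affine_point e \<beta> ` S" for P
  proof -
    obtain u where u: "u \<in> S" "P = affine_point e \<beta> u" using P by blast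
    have "u ^ CARD('a) = u"
      unfolding assms(3) using u(1) parameter_power_square[OF assms(2) char' \<beta>] by (simp add: S_def)
    then obtain v where v: "u = to_ac v" using range_to_ac_finite by blast
    have "to_ac (trace_sum e v) = trace_sum e u" by (simp add: trace_sum_def to_ac_sum v)
    \<comment> \<open>T has coefficients in the prime field and \<open>\<beta>\<close> comes from
      \<open>\<alpha>\<close>, so a rational parameter \<open>v\<close> makes the normalized
      coordinates rational.\<close>
    then have "(to_ac (trace_sum e v), to_ac (v - \<alpha> ^ 2 ^ e * trace_sum e v), to_ac 1) \<in> P"
      unfolding u(2) affine_point_def
      by (auto simp: proj_rel_class v \<beta>_def intro!: exI[of _ 1])
    then show ?thesis unfolding rational_point_def by blast
  qed
  ultimately show ?thesis using plane irr points by simp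
qed

end
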